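(* Let $\Omega\subset\mathbb{C}^m$ be a Carathéodory hyperbolic domain and let $\Psi\subset\mathscr{S}(\Omega)$ be a set of test functions on $\Omega$ such that, for some $w_0\in\Omega$, $\psi(w_0)=0$ for all $\psi\in\Psi$. Then for all $z_1,z_2\in\Omega$, $$d_\Psi(z_1,z_2)=\inf\Big\{\sqrt{1-\frac{|k(z_1,z_2)|^2}{k(z_1,z_1)k(z_2,z_2)}}\;:\; k\in\mathcal{K}_\Psi,\ k(z_1,z_1)\neq 0\neq k(z_2,z_2)\Big\}.$$
   Context: $\mathbb{D}$ is the open unit disc in $\mathbb{C}$. A domain $\Omega\subset\mathbb{C}^m$ is Carathéodory hyperbolic if the bounded holomorphic functions on $\Omega$ separate the points of $\Omega$. The Schur class $\mathscr{S}(\Omega)$ is the closed unit ball, for the supremum norm, of the Banach algebra of bounded holomorphic functions $\Omega\to\mathbb{C}$. A collection $\Psi$ of $\mathbb{C}$-valued functions on $\Omega$ is a set of test functions if (i) $\sup\{|\psi(z)|:\psi\in\Psi\}<1$ for each $z\in\Omega$; and (ii) for each finite subset $F\subset\Omega$, the restrictions $\{\psi|_F:\psi\in\Psi\}$ together with the constant function generate the algebra of all $\mathbb{C}$-valued functions on $F$. For a function $G:\Omega\times\Omega\to\mathbb{C}$, the notation $(G(z,w))_{z,w\in\Omega}\ge\mathbf{0}$ means $G$ is positive semidefinite: for each finite list $z_1,\dots,z_n\in\Omega$ the matrix $(G(z_i,z_j))_{i,j}$ is positive semidefinite. The set $\mathcal{K}_\Psi$ of $\Psi$-admissible kernels consists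 of all positive semidefinite functions $k:\Omega\times\Omega\to\mathbb{C}$ such that $\big((1-\psi(z)\overline{\psi(w)})k(z,w)\big)_{z,w\in\Omega}\ge\mathbf{0}$ for all $\psi\in\Psi$. The $\Psi$-Schur-Agler class $\mathscr{SA}_\Psi$ is the set of all functions $f:\Omega\to\mathbb{C}$ such that $\big((1-f(z)\overline{f(w)})k(z,w)\big)_{z,w\in\Omega}\ge\mathbf{0}$ for all $k\in\mathcal{K}_\Psi$. For $a,b\in\mathbb{D}$ put $m(a,b)=\left|\frac{a-b}{1-a\overline{b}}\right|$. For $z_1,z_2\in\Omega$ define $$d_\Psi(z_1,z_2)=\sup\{m(f(z_1),f(z_2)): f\in\mathscr{SA}_\Psi,\ f(\Omega)\subset\mathbb{D}\}.$$ *)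

theory Defs
  imports "HOL-Analysis.Analysis"
begin

text \<open>
  A function on \<open>\<Omega>\<close> is rendered as a total function of which only the values on \<open>\<Omega>\<close> matter, and
  a kernel \<open>\<Omega> \<times> \<Omega> \<rightarrow> \<complex>\<close> as a curried function of two arguments.
\<close>

definition complex_domain :: "(complex ^ 'm) set \<Rightarrow> bool" where
  "complex_domain \<Omega> \<longleftrightarrow> open \<Omega> \<and> connected \<Omega> \<and> \<Omega> \<noteq> {}"

text \<open>
  The library's holomorphy covers one variable only. In several variables: a \<open>\<complex>\<close>-linear Frechet
  derivative exists at every point (\<open>has_derivative\<close> itself gives only real linearity).
\<close>

definition holomorphic_multi :: "(complex ^ 'm) set \<Rightarrow> (complex ^ 'm \<Rightarrow> complex) \<Rightarrow> bool" where
  "holomorphic_multi \<Omega> f \<longleftrightarrow>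
    (\<forall>z\<in>\<Omega>. \<exists>D. (f has_derivative D) (at z within \<Omega>) \<and> (\<forall>c v. D (c *s v) = c * D v))"

definition caratheodory_hyperbolic :: "(complex ^ 'm) set \<Rightarrow> bool" where
  "caratheodory_hyperbolic \<Omega> \<longleftrightarrow>
    (\<forall>z\<in>\<Omega>. \<forall>w\<in>\<Omega>. z \<noteq> w \<longrightarrow> (\<exists>f. holomorphic_multi \<Omega> f \<and> bounded (f ` \<Omega>) \<and> f z \<noteq> f w))"

definition schur_class :: "(complex ^ 'm) set \<Rightarrow> (complex ^ 'm \<Rightarrow> complex) set" where
  "schur_class \<Omega> = {f. holomorphic_multi \<Omega> f \<and> (\<forall>z\<in>\<Omega>. cmod (f z) \<le> 1)}"

text \<open>
  The algebra of functions on \<open>F\<close> (elements of \<open>extensional F\<close>) generated by \<open>S\<close>. No unit is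
  added: the constant function has to be put into \<open>S\<close>.
\<close>

inductive_set generated_algebra :: "'a set \<Rightarrow> ('a \<Rightarrow> complex) set \<Rightarrow> ('a \<Rightarrow> complex) set"
  for F :: "'a set" and S :: "('a \<Rightarrow> complex) set" where
  gen: "f \<in> S \<Longrightarrow> f \<in> generated_algebra F S"
| add: "f \<in> generated_algebra F S \<Longrightarrow> g \<in> generated_algebra F S
    \<Longrightarrow> (\<lambda>z\<in>F. f z + g z) \<in> generated_algebra F S"
| mult: "f \<in> generated_algebra F S \<Longrightarrow> g \<in> generated_algebra F S
    \<Longrightarrow> (\<lambda>z\<in>F. f z * g z) \<in> generated_algebra F S"
| scale: "f \<in> generated_algebra F S \<Longrightarrow> (\<lambda>z\<in>F. c * f z) \<in> generated_algebra F S"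

text \<open>
  The supremum is taken in \<open>[0, \<infinity>]\<close>, so that it is meaningful for every collection \<open>\<Psi>\<close>.
\<close>

definition test_functions :: "'a set \<Rightarrow> ('a \<Rightarrow> complex) set \<Rightarrow> bool" where
  "test_functions \<Omega> \<Psi> \<longleftrightarrow>
    (\<forall>z\<in>\<Omega>. (SUP \<psi>\<in>\<Psi>. ennreal (cmod (\<psi> z))) < 1) \<and>
    (\<forall>F. finite F \<and> F \<subseteq> \<Omega> \<longrightarrow>
      generated_algebra F (insert (\<lambda>z\<in>F. 1) ((\<lambda>\<psi>. restrict \<psi> F) ` \<Psi>)) = extensional F)"

text \<open>
  Membership in \<open>\<real>\<^sub>\<ge>\<^sub>0\<close> says that the quadratic form is real and nonnegative; over \<open>\<complex>\<close> this forces
  the matrix to be Hermitian, with real nonnegative diagonal entries.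
\<close>

definition psd_matrix :: "nat \<Rightarrow> (nat \<Rightarrow> nat \<Rightarrow> complex) \<Rightarrow> bool" where
  "psd_matrix n A \<longleftrightarrow> (\<forall>c :: nat \<Rightarrow> complex. (\<Sum>i<n. \<Sum>j<n. cnj (c i) * A i j * c j) \<in> \<real>\<^sub>\<ge>\<^sub>0)"

definition psd_on :: "'a set \<Rightarrow> ('a \<Rightarrow> 'a \<Rightarrow> complex) \<Rightarrow> bool" where
  "psd_on \<Omega> G \<longleftrightarrow>
    (\<forall>zs. set zs \<subseteq> \<Omega> \<longrightarrow> psd_matrix (length zs) (\<lambda>i j. G (zs ! i) (zs ! j)))"

definition admissible_kernels :: "'a set \<Rightarrow> ('a \<Rightarrow> complex) set \<Rightarrow> ('a \<Rightarrow> 'a \<Rightarrow> complex) set" where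
  "admissible_kernels \<Omega> \<Psi> =
    {k. psd_on \<Omega> k \<and> (\<forall>\<psi>\<in>\<Psi>. psd_on \<Omega> (\<lambda>z w. (1 - \<psi> z * cnj (\<psi> w)) * k z w))}"

definition schur_agler_class :: "'a set \<Rightarrow> ('a \<Rightarrow> complex) set \<Rightarrow> ('a \<Rightarrow> complex) set" where
  "schur_agler_class \<Omega> \<Psi> =
    {f. \<forall>k\<in>admissible_kernels \<Omega> \<Psi>. psd_on \<Omega> (\<lambda>z w. (1 - f z * cnj (f w)) * k z w)}"

definition moebius_dist :: "complex \<Rightarrow> complex \<Rightarrow> real" where
  "moebius_dist a b = cmod ((a - b) / (1 - a * cnj b))"

text \<open>
  The set of distances is bounded by \<open>1\<close> and contains \<open>0\<close> (take \<open>f = 0\<close>), so the real-valued \<open>Sup\<close>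
  is the actual supremum.
\<close>

definition d_Psi :: "'a set \<Rightarrow> ('a \<Rightarrow> complex) set \<Rightarrow> 'a \<Rightarrow> 'a \<Rightarrow> real" where
  "d_Psi \<Omega> \<Psi> z1 z2 =
    Sup {moebius_dist (f z1) (f z2) | f. f \<in> schur_agler_class \<Omega> \<Psi> \<and> f ` \<Omega> \<subseteq> ball 0 1}"

end

theory Submission imports Defs begin

text \<open>
  One inequality is the determinant of a \<open>2 \<times> 2\<close> matrix. If \<open>f\<close> is in the Schur-Agler class and \<open>k\<close>
  is admissible, then the matrix of \<open>(1 - f(z_i) cnj (f(z_j))) k(z_i, z_j)\<close> is positive semidefinite,
  and its Cauchy-Schwarz inequality together with
  \<open>|1 - a cnj b|\<^sup>2 - |a - b|\<^sup>2 = (1 - |a|\<^sup>2) (1 - |b|\<^sup>2)\<close> bounds the Moebius distance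
  of \<open>f(z_1)\<close> and \<open>f(z_2)\<close> (\<open>moebius_dist_kernel_bound\<close>).

  For the other inequality, a function of the Schur-Agler class with \<open>f(z_1) = 0\<close> and \<open>f(z_2) = t\<close>
  is constructed for every \<open>t > 0\<close> below the infimum
  (\<open>schur_agler_two_point_interpolation\<close>); a scalar multiple of \<open>f\<close> then has values in the open
  disc and realizes any prescribed smaller distance. The construction has two halves.

  Duality (\<open>two_point_agler_decomposition\<close>): on \<open>{z_1, z_2}\<close> consider the convex cone of Hermitian
  matrices generated by the matrices of \<open>(1 - \<psi>(z) cnj (\<psi>(w))) u(z) cnj (u(w))\<close>, where
  \<open>\<psi>\<close> is a test function or \<open>0\<close>. A hyperplane separating the matrix of
  \<open>1 - g(z) cnj (g(w))\<close>, with \<open>g(z_1) = 0\<close> and \<open>g(z_2) = t\<close>, from this cone is itself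
  an admissible kernel, supported on the two points, and it would violate the choice of \<open>t\<close>. So the
  matrix is a finite sum of generators.

  Extension (\<open>agler_decomposition_extends\<close>): such a finite decomposition is an equality of two Gram
  matrices of vectors in a finite-dimensional space, so an isometry \<open>V\<close> carries the one family of
  vectors to the other. As the test functions are strictly smaller than 1 in modulus at each point,
  the equation that \<open>V\<close> expresses on \<open>{z_1, z_2}\<close> has a solution at every point of \<open>\<Omega>\<close>, and
  since \<open>V\<close> preserves inner products the solutions satisfy the same decomposition on all of
  \<open>\<Omega>\<close>. A function with such a decomposition is in the Schur-Agler class, because multiplying it by
  an admissible kernel gives a sum of positive semidefinite kernels.
\<close>

section \<open>Positive semidefinite kernels\<close>

lemma psd_on_quadratic_form:
  assumes "psd_on \<Omega> G" "set zs \<subseteq> \<Omega>"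
  shows "(\<Sum>i<length zs. \<Sum>j<length zs. cnj (c i) * G (zs ! i) (zs ! j) * c j) \<in> \<real>\<^sub>\<ge>\<^sub>0"
  using assms unfolding psd_on_def psd_matrix_def by blast

lemma psd_onI:
  assumes "\<And>zs c. set zs \<subseteq> \<Omega> \<Longrightarrow>
    (\<Sum>i<length zs. \<Sum>j<length zs. cnj (c i) * G (zs ! i) (zs ! j) * c j) \<in> \<real>\<^sub>\<ge>\<^sub>0"
  shows "psd_on \<Omega> G"
  using assms unfolding psd_on_def psd_matrix_def by blast

lemma psd_on_cong:
  assumes "psd_on \<Omega> G" "\<And>z w. z \<in> \<Omega> \<Longrightarrow> w \<in> \<Omega> \<Longrightarrow> G z w = H z w"
  shows "psd_on \<Omega> H"
proof (rule psd_onI)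
  fix zs and c :: "nat \<Rightarrow> complex"
  assume zs: "set zs \<subseteq> \<Omega>"
  have "(\<Sum>i<length zs. \<Sum>j<length zs. cnj (c i) * G (zs ! i) (zs ! j) * c j)
      = (\<Sum>i<length zs. \<Sum>j<length zs. cnj (c i) * H (zs ! i) (zs ! j) * c j)"
    using zs by (intro sum.cong refl) (simp add: assms(2) subset_iff)
  with psd_on_quadratic_form[OF assms(1) zs, of c]
  show "(\<Sum>i<length zs. \<Sum>j<length zs. cnj (c i) * H (zs ! i) (zs ! j) * c j) \<in> \<real>\<^sub>\<ge>\<^sub>0"
    by simp
qed

lemma psd_on_zero: "psd_on \<Omega> (\<lambda>z w. 0)"
  by (rule psd_onI) simp

lemma psd_on_add:
  assumes "psd_on \<Omega> G" "psd_on \<Omega> H"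
  shows "psd_on \<Omega> (\<lambda>z w. G z w + H z w)"
proof (rule psd_onI)
  fix zs and c :: "nat \<Rightarrow> complex"
  assume zs: "set zs \<subseteq> \<Omega>"
  show "(\<Sum>i<length zs. \<Sum>j<length zs. cnj (c i) * (G (zs ! i) (zs ! j) + H (zs ! i) (zs ! j)) * c j) \<in> \<real>\<^sub>\<ge>\<^sub>0"
    using nonneg_Reals_add_I[OF psd_on_quadratic_form[OF assms(1) zs, of c]
        psd_on_quadratic_form[OF assms(2) zs, of c]]
    by (simp add: algebra_simps sum.distrib)
qed

lemma psd_on_sum:
  assumes "\<And>l. l \<in> S \<Longrightarrow> psd_on \<Omega> (G l)"
  shows "psd_on \<Omega> (\<lambda>z w. \<Sum>l\<in>S. G l z w)"
  using assms by (induction S rule: infinite_finite_induct) (simp_all add: psd_on_zero psd_on_add)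

text \<open>
  Only products with a kernel of rank one occur below, so this congruence takes the place of the
  Schur product theorem.
\<close>

lemma psd_on_congruence:
  assumes "psd_on \<Omega> G"
  shows "psd_on \<Omega> (\<lambda>z w. h z * cnj (h w) * G z w)"
proof (rule psd_onI)
  fix zs and c :: "nat \<Rightarrow> complex"
  assume zs: "set zs \<subseteq> \<Omega>"
  show "(\<Sum>i<length zs. \<Sum>j<length zs. cnj (c i) * (h (zs ! i) * cnj (h (zs ! j)) * G (zs ! i) (zs ! j)) * c j) \<in> \<real>\<^sub>\<ge>\<^sub>0"
    using psd_on_quadratic_form[OF assms zs, of "\<lambda>i. cnj (h (zs ! i)) * c i"]
    by (simp add: mult_ac)
qed

lemma psd_on_scale:
  assumes "psd_on \<Omega> G" "0 \<le> r"
  shows "psd_on \<Omega> (\<lambda>z w. of_real r * G z w)"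
  using psd_on_congruence[OF assms(1), of "\<lambda>_. of_real (sqrt r)"] assms(2)
  by (simp flip: of_real_mult)

text \<open>
  A list of points may repeat points and leave \<open>F\<close>. Collecting the coefficients of equal points
  turns its quadratic form into the form on \<open>F\<close>; in particular, an admissible kernel on a finite
  set extends by zero to an admissible kernel on \<open>\<Omega>\<close>.
\<close>

lemma psd_onI_finite_support:
  fixes G :: "'a \<Rightarrow> 'a \<Rightarrow> complex"
  assumes F: "finite F"
    and support: "\<And>z w. z \<notin> F \<or> w \<notin> F \<Longrightarrow> G z w = 0"
    and form: "\<And>c. (\<Sum>p\<in>F. \<Sum>q\<in>F. cnj (c p) * G p q * c q) \<in> \<real>\<^sub>\<ge>\<^sub>0"
  shows "psd_on \<Omega> G"
proof (rule psd_onI)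
  fix zs :: "'a list" and c :: "nat \<Rightarrow> complex"
  let ?n = "length zs"
  define e where "e = (\<lambda>i p. of_bool (zs ! i = p) :: complex)"
  define C where "C = (\<lambda>p. \<Sum>i<?n. c i * e i p)"
  have cnj_e: "cnj (e i p) = e i p" for i p by (simp add: e_def)
  have G: "G (zs ! i) (zs ! j) = (\<Sum>p\<in>F. \<Sum>q\<in>F. e i p * G p q * e j q)" for i j
  proof -
    have "(\<Sum>p\<in>F. \<Sum>q\<in>F. e i p * G p q * e j q)
        = (\<Sum>p\<in>F. if p = zs ! i then (\<Sum>q\<in>F. if q = zs ! j then G p q else 0) else 0)"
      by (intro sum.cong refl) (auto simp: e_def intro!: sum.cong)
    also have "\<dots> = G (zs ! i) (zs ! j)"
      using F support[of "zs ! i" "zs ! j"] by (auto simp: sum.delta)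
    finally show ?thesis by simp
  qed
  have "(\<Sum>i<?n. \<Sum>j<?n. cnj (c i) * G (zs ! i) (zs ! j) * c j)
      = (\<Sum>i<?n. \<Sum>j<?n. \<Sum>p\<in>F. \<Sum>q\<in>F. cnj (c i * e i p) * G p q * (c j * e j q))"
    by (simp add: G sum_distrib_left sum_distrib_right cnj_e mult_ac)
  also have "\<dots> = (\<Sum>i<?n. \<Sum>p\<in>F. \<Sum>j<?n. \<Sum>q\<in>F. cnj (c i * e i p) * G p q * (c j * e j q))"
    by (intro sum.cong refl sum.swap)
  also have "\<dots> = (\<Sum>p\<in>F. \<Sum>i<?n. \<Sum>j<?n. \<Sum>q\<in>F. cnj (c i * e i p) * G p q * (c j * e j q))"
    by (rule sum.swap)
  also have "\<dots> = (\<Sum>p\<in>F. \<Sum>i<?n. \<Sum>q\<in>F. \<Sum>j<?n. cnj (c i * e i p) * G p q * (c j * e j q))"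
    by (intro sum.cong refl sum.swap)
  also have "\<dots> = (\<Sum>p\<in>F. \<Sum>q\<in>F. \<Sum>i<?n. \<Sum>j<?n. cnj (c i * e i p) * G p q * (c j * e j q))"
    by (intro sum.cong refl sum.swap)
  also have "\<dots> = (\<Sum>p\<in>F. \<Sum>q\<in>F. \<Sum>j<?n. \<Sum>i<?n. cnj (c i * e i p) * G p q * (c j * e j q))"
    by (intro sum.cong refl sum.swap)
  also have "\<dots> = (\<Sum>p\<in>F. \<Sum>q\<in>F. cnj (C p) * G p q * C q)"
    by (simp add: C_def sum_distrib_left sum_distrib_right)
  finally show "(\<Sum>i<?n. \<Sum>j<?n. cnj (c i) * G (zs ! i) (zs ! j) * c j) \<in> \<real>\<^sub>\<ge>\<^sub>0"
    using form[of C] by simp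
qed

lemma psd_on_diagonal:
  assumes "psd_on \<Omega> G" "z \<in> \<Omega>"
  shows "G z z \<in> \<real>\<^sub>\<ge>\<^sub>0"
  using psd_on_quadratic_form[OF assms(1), of "[z]" "\<lambda>_. 1"] assms(2) by simp

lemma psd_on_two_points:
  assumes "psd_on \<Omega> G" "z \<in> \<Omega>" "w \<in> \<Omega>"
  shows "cnj a * G z z * a + cnj a * G z w * b + cnj b * G w z * a + cnj b * G w w * b \<in> \<real>\<^sub>\<ge>\<^sub>0"
  using psd_on_quadratic_form[OF assms(1), of "[z, w]" "\<lambda>i. if i = 0 then a else b"] assms(2,3)
  by (simp add: lessThan_Suc add_ac)

lemma psd_on_hermitian:
  assumes "psd_on \<Omega> G" "z \<in> \<Omega>" "w \<in> \<Omega>"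
  shows "G w z = cnj (G z w)"
proof -
  have *: "Im (G z z) = 0" "Im (G w w) = 0"
    using psd_on_diagonal[OF assms(1)] assms(2,3) by (auto simp: complex_nonneg_Reals_iff)
  have "Im (G z w + G w z) = 0"
    using psd_on_two_points[OF assms, of 1 1] * by (simp add: complex_nonneg_Reals_iff)
  moreover have "Re (G z w) - Re (G w z) = 0"
    using psd_on_two_points[OF assms, of 1 \<i>] * by (simp add: complex_nonneg_Reals_iff)
  ultimately show ?thesis by (simp add: complex_eq_iff)
qed

lemma psd_on_cauchy_schwarz:
  assumes "psd_on \<Omega> G" "z \<in> \<Omega>" "w \<in> \<Omega>"
  shows "(cmod (G z w))\<^sup>2 \<le> Re (G z z) * Re (G w w)"
proof -
  define A B g where "A = Re (G z z)" and "B = Re (G w w)" and "g = G z w"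
  have zz: "G z z = of_real A" and ww: "G w w = of_real B" and A: "0 \<le> A" and B: "0 \<le> B"
    using psd_on_diagonal[OF assms(1)] assms(2,3)
    by (auto simp: complex_nonneg_Reals_iff A_def B_def complex_eq_iff)
  have wz: "G w z = cnj g" using psd_on_hermitian[OF assms] by (simp add: g_def)
  have ineq: "0 \<le> A * (cmod a)\<^sup>2 + 2 * Re (cnj a * g * b) + B * (cmod b)\<^sup>2" for a b
  proof -
    have "cnj a * G z z * a + cnj a * G z w * b + cnj b * G w z * a + cnj b * G w w * b
      = of_real (A * (cmod a)\<^sup>2) + (cnj a * g * b + cnj (cnj a * g * b)) + of_real (B * (cmod b)\<^sup>2)"
      unfolding zz ww wz g_def[symmetric]
      by (simp add: complex_norm_square mult_ac del: of_real_power)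
    also have "\<dots> = of_real (A * (cmod a)\<^sup>2 + 2 * Re (cnj a * g * b) + B * (cmod b)\<^sup>2)"
      by (simp only: complex_add_cnj of_real_add)
    finally show ?thesis using psd_on_two_points[OF assms, of a b] by (simp del: of_real_add of_real_mult)
  qed
  (* The choice b = cnj g, a = -t makes the cross term real, leaving a quadratic polynomial in t. *)
  have quad: "0 \<le> A * t\<^sup>2 - 2 * t * (cmod g)\<^sup>2 + B * (cmod g)\<^sup>2" for t
  proof -
    have "Re (cnj (complex_of_real (- t)) * g * cnj g) = - t * (cmod g)\<^sup>2"
      by (simp add: cmod_power2, simp add: power2_eq_square algebra_simps)
    with ineq[of "of_real (- t)" "cnj g"] show ?thesis by (simp add: mult_ac)
  qed
  have "(cmod g)\<^sup>2 \<le> A * B"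
  proof (cases "A = 0")
    case True
    (* For A = 0 the polynomial is affine in t, and any t > B / 2 forces g = 0. *)
    have "0 \<le> - (2 * (B + 1)) * (cmod g)\<^sup>2 + B * (cmod g)\<^sup>2"
      using quad[of "B + 1"] True by (simp add: algebra_simps)
    hence "(B + 2) * (cmod g)\<^sup>2 \<le> 0" by (simp add: algebra_simps)
    with B have "(cmod g)\<^sup>2 \<le> 0" by (simp add: mult_le_0_iff)
    thus ?thesis using True by simp
  next
    case False
    with A have Ap: "A > 0" by simp
    define t where "t = (cmod g)\<^sup>2 / A"
    have At: "(cmod g)\<^sup>2 = A * t" using Ap by (simp add: t_def)
    have "0 \<le> A * t * (B - t)"
      using quad[of t] unfolding At by (simp add: algebra_simps power2_eq_square)
    hence "A * t = 0 \<or> t \<le> B" using At by (smt (verit) mult_le_0_iff mult_nonneg_nonpos zero_le_power2 mult_pos_neg)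
    thus ?thesis
    proof
      assume "A * t = 0" thus ?thesis using At mult_nonneg_nonneg[OF A B] by linarith
    next
      assume "t \<le> B" thus ?thesis using At Ap by simp
    qed
  qed
  thus ?thesis by (simp add: A_def B_def g_def)
qed

section \<open>Admissible kernels and the Schur-Agler class\<close>

text \<open>
  Positivity of \<open>k\<close> itself is the condition for the test function \<open>0\<close>. Adjoining \<open>0\<close> to
  \<open>\<Psi>\<close> therefore leaves the admissible kernels unchanged, and lets the arguments below treat
  both conditions alike.
\<close>

lemma admissible_kernels_psd:
  assumes "k \<in> admissible_kernels \<Omega> \<Psi>" "\<psi> \<in> insert (\<lambda>_. 0) \<Psi>"
  shows "psd_on \<Omega> (\<lambda>z w. (1 - \<psi> z * cnj (\<psi> w)) * k z w)"
  using assms by (auto simp: admissible_kernels_def)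

lemma admissible_kernelsI:
  assumes "\<And>\<psi>. \<psi> \<in> insert (\<lambda>_. 0) \<Psi> \<Longrightarrow> psd_on \<Omega> (\<lambda>z w. (1 - \<psi> z * cnj (\<psi> w)) * k z w)"
  shows "k \<in> admissible_kernels \<Omega> \<Psi>"
  using assms assms[of "\<lambda>_. 0"] by (auto simp: admissible_kernels_def)

text \<open>
  These kernels show that the infimum is taken over a nonempty set, and testing with them bounds the
  functions of the Schur-Agler class by 1.
\<close>

lemma diagonal_kernel_admissible:
  assumes F: "finite F" "F \<subseteq> \<Omega>"
    and bound: "\<And>\<psi> z. \<psi> \<in> \<Psi> \<Longrightarrow> z \<in> \<Omega> \<Longrightarrow> cmod (\<psi> z) < 1"
  shows "(\<lambda>z w. of_bool (z = w \<and> z \<in> F)) \<in> admissible_kernels \<Omega> \<Psi>"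
proof (rule admissible_kernelsI, rule psd_onI_finite_support[OF F(1)])
  fix \<psi> and c :: "_ \<Rightarrow> complex"
  assume "\<psi> \<in> insert (\<lambda>_. 0) \<Psi>"
  with bound F have le: "cmod (\<psi> p) \<le> 1" if "p \<in> F" for p
    using that by (force intro: less_imp_le)
  have "(\<Sum>q\<in>F. cnj (c p) * ((1 - \<psi> p * cnj (\<psi> q)) * of_bool (p = q \<and> p \<in> F)) * c q)
      = of_real ((1 - (cmod (\<psi> p))\<^sup>2) * (cmod (c p))\<^sup>2)" if "p \<in> F" for p
  proof -
    have "(\<Sum>q\<in>F. cnj (c p) * ((1 - \<psi> p * cnj (\<psi> q)) * of_bool (p = q \<and> p \<in> F)) * c q)
        = (\<Sum>q\<in>F. if q = p then cnj (c p) * (1 - \<psi> p * cnj (\<psi> p)) * c p else 0)"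
      using that by (intro sum.cong) auto
    also have "\<dots> = cnj (c p) * (1 - \<psi> p * cnj (\<psi> p)) * c p"
      using F(1) that by simp
    also have "\<dots> = of_real ((1 - (cmod (\<psi> p))\<^sup>2) * (cmod (c p))\<^sup>2)"
      by (simp add: complex_norm_square mult_ac del: of_real_power)
    finally show ?thesis .
  qed
  hence "(\<Sum>p\<in>F. \<Sum>q\<in>F. cnj (c p) * ((1 - \<psi> p * cnj (\<psi> q)) * of_bool (p = q \<and> p \<in> F)) * c q)
      = of_real (\<Sum>p\<in>F. (1 - (cmod (\<psi> p))\<^sup>2) * (cmod (c p))\<^sup>2)"
    by simp
  moreover have "0 \<le> (\<Sum>p\<in>F. (1 - (cmod (\<psi> p))\<^sup>2) * (cmod (c p))\<^sup>2)"
    using le by (intro sum_nonneg mult_nonneg_nonneg) (auto simp: power_le_one)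
  ultimately show "(\<Sum>p\<in>F. \<Sum>q\<in>F. cnj (c p) * ((1 - \<psi> p * cnj (\<psi> q)) * of_bool (p = q \<and> p \<in> F)) * c q) \<in> \<real>\<^sub>\<ge>\<^sub>0"
    by (simp del: of_real_sum)
qed auto

lemma schur_agler_class_norm_le_one:
  assumes f: "f \<in> schur_agler_class \<Omega> \<Psi>" and z: "z \<in> \<Omega>"
    and bound: "\<And>\<psi> z. \<psi> \<in> \<Psi> \<Longrightarrow> z \<in> \<Omega> \<Longrightarrow> cmod (\<psi> z) < 1"
  shows "cmod (f z) \<le> 1"
proof -
  have "(\<lambda>v w. of_bool (v = w \<and> v \<in> {z})) \<in> admissible_kernels \<Omega> \<Psi>"
    using diagonal_kernel_admissible[of "{z}" \<Omega> \<Psi>] z bound by blast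
  with f have "psd_on \<Omega> (\<lambda>v w. (1 - f v * cnj (f w)) * of_bool (v = w \<and> v \<in> {z}))"
    unfolding schur_agler_class_def mem_Collect_eq by (rule bspec)
  from psd_on_diagonal[OF this z] have "Re (1 - f z * cnj (f z)) \<ge> 0"
    by (simp add: complex_nonneg_Reals_iff)
  hence "(cmod (f z))\<^sup>2 \<le> 1"
    by (simp add: cmod_power2, simp add: power2_eq_square)
  thus ?thesis using norm_ge_zero power_le_one_iff by (metis abs_norm_cancel abs_square_le_1)
qed

text \<open>
  With \<open>r f\<close> in place of \<open>f\<close> the kernel becomes the convex combination
  \<open>(1 - r\<^sup>2) k(z, w) + r\<^sup>2 (1 - f(z) cnj (f(w))) k(z, w)\<close>.
\<close>

lemma schur_agler_class_scale:
  assumes f: "f \<in> schur_agler_class \<Omega> \<Psi>" and r: "0 \<le> r" "r \<le> 1"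
  shows "(\<lambda>z. of_real r * f z) \<in> schur_agler_class \<Omega> \<Psi>"
  unfolding schur_agler_class_def
proof (safe)
  fix k assume k: "k \<in> admissible_kernels \<Omega> \<Psi>"
  have "psd_on \<Omega> (\<lambda>z w. of_real (1 - r\<^sup>2) * k z w + of_real (r\<^sup>2) * ((1 - f z * cnj (f w)) * k z w))"
    using f k r by (intro psd_on_add psd_on_scale)
      (auto simp: schur_agler_class_def admissible_kernels_def power_le_one)
  thus "psd_on \<Omega> (\<lambda>z w. (1 - of_real r * f z * cnj (of_real r * f w)) * k z w)"
    by (rule psd_on_cong) (simp add: algebra_simps power2_eq_square)
qed

text \<open>
  The easy half of Agler's characterization of the class: after multiplication by an admissible \<open>k\<close>,
  each summand is a congruence of \<open>(1 - \<phi>(z) cnj (\<phi>(w))) k(z, w)\<close>.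
\<close>

lemma schur_agler_class_decomposition:
  assumes \<phi>: "\<And>l. l \<in> S \<Longrightarrow> \<phi> l \<in> insert (\<lambda>_. 0) \<Psi>"
    and dec: "\<And>z w. z \<in> \<Omega> \<Longrightarrow> w \<in> \<Omega> \<Longrightarrow>
      1 - f z * cnj (f w) = (\<Sum>l\<in>S. (1 - \<phi> l z * cnj (\<phi> l w)) * (h l z * cnj (h l w)))"
  shows "f \<in> schur_agler_class \<Omega> \<Psi>"
  unfolding schur_agler_class_def
proof (safe)
  fix k assume k: "k \<in> admissible_kernels \<Omega> \<Psi>"
  have "psd_on \<Omega> (\<lambda>z w. \<Sum>l\<in>S. h l z * cnj (h l w) * ((1 - \<phi> l z * cnj (\<phi> l w)) * k z w))"
    by (intro psd_on_sum psd_on_congruence admissible_kernels_psd[OF k] \<phi>)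
  thus "psd_on \<Omega> (\<lambda>z w. (1 - f z * cnj (f w)) * k z w)"
    by (rule psd_on_cong) (simp add: dec sum_distrib_right, simp add: mult_ac)
qed

section \<open>The lurking isometry\<close>

text \<open>
  The dimension of the space on which the isometry acts is the number of summands of a decomposition,
  which is only known inside a proof. Its vectors are therefore functions on an arbitrary index type,
  of which only the coordinates in a finite set \<open>J\<close> count.
\<close>

definition coord_inner :: "'j set \<Rightarrow> ('j \<Rightarrow> complex) \<Rightarrow> ('j \<Rightarrow> complex) \<Rightarrow> complex" where
  "coord_inner J x y = (\<Sum>j\<in>J. x j * cnj (y j))"

definition coord_norm :: "'j set \<Rightarrow> ('j \<Rightarrow> complex) \<Rightarrow> real" where
  "coord_norm J x = L2_set (\<lambda>j. cmod (x j)) J"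

definition coord_linear :: "(('j \<Rightarrow> complex) \<Rightarrow> 'j \<Rightarrow> complex) \<Rightarrow> bool" where
  "coord_linear V \<longleftrightarrow> (\<forall>x y c. V (\<lambda>j. x j + c * y j) = (\<lambda>j. V x j + c * V y j))"

definition coord_isometry :: "'j set \<Rightarrow> (('j \<Rightarrow> complex) \<Rightarrow> 'j \<Rightarrow> complex) \<Rightarrow> bool" where
  "coord_isometry J V \<longleftrightarrow> (\<forall>x y. coord_inner J (V x) (V y) = coord_inner J x y)"

lemma coord_inner_self: "coord_inner J x x = of_real ((coord_norm J x)\<^sup>2)"
  by (simp add: coord_inner_def coord_norm_def L2_set_def sum_nonneg complex_norm_square
      del: of_real_power)

lemma coord_norm_nonneg: "0 \<le> coord_norm J x"
  by (simp add: coord_norm_def)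

lemma coord_norm_eq_0_iff: "finite J \<Longrightarrow> coord_norm J x = 0 \<longleftrightarrow> (\<forall>j\<in>J. x j = 0)"
  by (simp add: coord_norm_def L2_set_eq_0_iff)

lemma coord_norm_triangle: "coord_norm J (\<lambda>j. x j - z j)
    \<le> coord_norm J (\<lambda>j. x j - y j) + coord_norm J (\<lambda>j. y j - z j)"
proof -
  have "coord_norm J (\<lambda>j. x j - z j) \<le> L2_set (\<lambda>j. cmod (x j - y j) + cmod (y j - z j)) J"
    unfolding coord_norm_def by (rule L2_set_mono) (auto intro: norm_diff_triangle_ineq norm_triangle_le order_trans[OF _ norm_triangle_ineq])
  also have "\<dots> \<le> coord_norm J (\<lambda>j. x j - y j) + coord_norm J (\<lambda>j. y j - z j)"
    unfolding coord_norm_def by (rule L2_set_triangle_ineq)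
  finally show ?thesis .
qed

lemma coord_inner_diff_right:
  "coord_inner J x (\<lambda>j. y j - z j) = coord_inner J x y - coord_inner J x z"
  by (simp add: coord_inner_def algebra_simps sum_subtractf)

lemma coord_inner_diff_left:
  "coord_inner J (\<lambda>j. y j - z j) x = coord_inner J y x - coord_inner J z x"
  by (simp add: coord_inner_def algebra_simps sum_subtractf)

lemma coord_inner_scale_left: "coord_inner J (\<lambda>j. c * x j) y = c * coord_inner J x y"
  by (simp add: coord_inner_def sum_distrib_left mult_ac)

lemma coord_inner_scale_right: "coord_inner J x (\<lambda>j. c * y j) = cnj c * coord_inner J x y"
  by (simp add: coord_inner_def sum_distrib_left mult_ac)

lemma coord_inner_cnj: "cnj (coord_inner J x y) = coord_inner J y x"
  by (simp add: coord_inner_def mult_ac)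

lemma coord_inner_cong:
  assumes "\<And>j. j \<in> J \<Longrightarrow> x j = x' j" "\<And>j. j \<in> J \<Longrightarrow> y j = y' j"
  shows "coord_inner J x y = coord_inner J x' y'"
  using assms by (simp add: coord_inner_def)

lemma coord_linear_diff:
  assumes "coord_linear V"
  shows "V (\<lambda>j. x j - y j) = (\<lambda>j. V x j - V y j)"
  using assms[unfolded coord_linear_def, rule_format, of x "-1" y] by simp

text \<open>
  The complex Householder reflection in \<open>w = u - v\<close>, namely
  \<open>x \<mapsto> x - (\<langle>x, w\<rangle> / \<langle>u, w\<rangle>) w\<close>. It sends \<open>u\<close> to \<open>v\<close> and fixes the orthogonal
  complement of \<open>w\<close>. It is isometric because \<open>2 Re \<langle>u, w\<rangle> = \<parallel>w\<parallel>\<^sup>2\<close>, which is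
  the equality of the norms of \<open>u\<close> and \<open>v\<close>.
\<close>

lemma householder:
  assumes J: "finite J" and norm: "coord_inner J u u = coord_inner J v v"
  shows "\<exists>H. coord_linear H \<and> coord_isometry J H \<and> (\<forall>j\<in>J. H u j = v j) \<and>
    (\<forall>x. coord_inner J x u = coord_inner J x v \<longrightarrow> H x = x)"
proof -
  define w where "w = (\<lambda>j. u j - v j)"
  define \<alpha> where "\<alpha> = coord_inner J u w"
  define H where "H = (\<lambda>x j. x j - (coord_inner J x w / \<alpha>) * w j)"
  have \<alpha>: "\<alpha> + cnj \<alpha> = coord_inner J w w"
    unfolding \<alpha>_def coord_inner_cnj unfolding w_def
    by (simp add: coord_inner_diff_left coord_inner_diff_right norm)
  have lin: "coord_linear H"
    unfolding coord_linear_def H_def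
    by (auto simp: coord_inner_def fun_eq_iff algebra_simps sum.distrib add_divide_distrib sum_distrib_left sum_divide_distrib)
  have fix_orth: "H x = x" if "coord_inner J x u = coord_inner J x v" for x
    using that by (simp add: H_def w_def coord_inner_diff_right)
  show ?thesis
  (* Here Re \<alpha> is half of the squared norm of w, so \<alpha> = 0 means u = v on J. *)
  proof (cases "\<alpha> = 0")
    case True
    hence "coord_inner J w w = 0" using \<alpha> by simp
    hence "\<forall>j\<in>J. w j = 0" using coord_norm_eq_0_iff[OF J] by (simp add: coord_inner_self)
    hence "coord_linear (\<lambda>x. x) \<and> coord_isometry J (\<lambda>x. x) \<and> (\<forall>j\<in>J. u j = v j)"
      by (simp add: coord_linear_def coord_isometry_def w_def)
    thus ?thesis by (intro exI[of _ "\<lambda>x. x"]) simp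
  next
    case False
    have "coord_inner J (H x) (H y) = coord_inner J x y" for x y
    proof -
      define p q where "p = coord_inner J x w" and "q = coord_inner J w y"
      have yw: "coord_inner J y w = cnj q" by (simp add: q_def coord_inner_cnj)
      have "coord_inner J (H x) (H y)
        = coord_inner J x y - q * p / cnj \<alpha> - p / \<alpha> * (q - q / cnj \<alpha> * (\<alpha> + cnj \<alpha>))"
        unfolding H_def yw coord_inner_diff_left coord_inner_diff_right
          coord_inner_scale_left coord_inner_scale_right \<alpha>
        by (simp add: p_def q_def algebra_simps)
      also have "\<dots> = coord_inner J x y" using False by (simp add: field_simps)
      finally show ?thesis .
    qed
    hence "coord_isometry J H" by (simp add: coord_isometry_def)
    moreover have "H u j = u j - w j" for j using False by (simp add: H_def \<alpha>_def[symmetric])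
    hence "H u j = v j" for j by (simp add: w_def)
    ultimately show ?thesis using lin fix_orth by blast
  qed
qed

text \<open>
  Induction over the points. If \<open>V\<close> is correct on \<open>F\<close>, the reflection taking \<open>V (a p)\<close> to
  \<open>b p\<close> repairs the new point, and equality of the Gram matrices says that every earlier
  \<open>b z\<close> is orthogonal to \<open>V (a p) - b p\<close> and hence stays fixed.
\<close>

lemma lurking_isometry:
  assumes J: "finite J" and "finite F"
    and gram: "\<And>z w. z \<in> F \<Longrightarrow> w \<in> F \<Longrightarrow> coord_inner J (a z) (a w) = coord_inner J (b z) (b w)"
  shows "\<exists>V. coord_linear V \<and> coord_isometry J V \<and> (\<forall>z\<in>F. \<forall>j\<in>J. V (a z) j = b z j)"
  using assms(2) gram
proof (induction F rule: finite_induct)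
  case empty
  show ?case by (rule exI[of _ "\<lambda>x. x"]) (simp add: coord_linear_def coord_isometry_def)
next
  case (insert p F)
  then obtain V where V: "coord_linear V" "coord_isometry J V" "\<forall>z\<in>F. \<forall>j\<in>J. V (a z) j = b z j"
    by (metis insertCI)
  have iso: "coord_inner J (V x) (V y) = coord_inner J x y" for x y
    using V(2) by (simp add: coord_isometry_def)
  obtain H where H: "coord_linear H" "coord_isometry J H" "\<forall>j\<in>J. H (V (a p)) j = b p j"
    and fixed: "\<And>x. coord_inner J x (V (a p)) = coord_inner J x (b p) \<Longrightarrow> H x = x"
    using householder[OF J, of "V (a p)" "b p"] insert.prems[of p p] iso by auto
  have "H (V (a z)) j = b z j" if z: "z \<in> F" and j: "j \<in> J" for z j
  proof -
    have "coord_inner J (V (a z)) (V (a p)) = coord_inner J (b z) (b p)"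
      using insert.prems[of z p] z iso by simp
    also have "\<dots> = coord_inner J (V (a z)) (b p)"
      using V(3) z by (intro coord_inner_cong) auto
    finally show ?thesis using fixed V(3) z j by simp
  qed
  with H V have "coord_linear (\<lambda>x. H (V x)) \<and> coord_isometry J (\<lambda>x. H (V x)) \<and>
      (\<forall>z\<in>insert p F. \<forall>j\<in>J. H (V (a z)) j = b z j)"
    by (simp add: coord_linear_def coord_isometry_def)
  thus ?case by blast
qed

section \<open>Extending a finite Agler decomposition\<close>

text \<open>
  Banach's fixed point theorem for the seminorm \<open>coord_norm J\<close>: the iterates converge in each
  coordinate of \<open>J\<close>, and the fixed point equation holds in these coordinates only.
\<close>

lemma coord_contraction_fixed_point:
  assumes J: "finite J" and r: "0 \<le> r" "r < 1"
    and contr: "\<And>x y. coord_norm J (\<lambda>j. T x j - T y j) \<le> r * coord_norm J (\<lambda>j. x j - y j)"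
  shows "\<exists>x. \<forall>j\<in>J. T x j = x j"
proof -
  define X where "X = (\<lambda>n. (T ^^ n) (\<lambda>_. 0))"
  have X_Suc: "X (Suc n) = T (X n)" for n by (simp add: X_def)
  define e where "e = coord_norm J (\<lambda>j. X 1 j - X 0 j)"
  have step: "coord_norm J (\<lambda>j. X (Suc n) j - X n j) \<le> r ^ n * e" for n
  proof (induction n)
    case (Suc n)
    show ?case
      using order_trans[OF contr[of "X (Suc n)" "X n"] mult_left_mono[OF Suc r(1)]]
      by (simp add: X_Suc)
  qed (simp add: e_def)
  have "convergent (\<lambda>n. X n j)" if j: "j \<in> J" for j
  proof -
    have "cmod (X (Suc n) j - X n j) \<le> r ^ n * e" for n
      using member_le_L2_set[OF J j, of "\<lambda>j. cmod (X (Suc n) j - X n j)"] step[of n]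
      by (simp add: coord_norm_def)
    moreover have "summable (\<lambda>n. r ^ n * e)"
      using r by (intro summable_mult2 summable_geometric) simp
    ultimately have "summable (\<lambda>n. X (Suc n) j - X n j)"
      by (rule summable_comparison_test'[rotated, where N = 0])
    hence "convergent (\<lambda>n. (X n j - X 0 j) + X 0 j)"
      by (intro convergent_add convergent_const)
        (simp add: summable_iff_convergent sum_lessThan_telescope[of "\<lambda>n. X n j"])
    thus ?thesis by simp
  qed
  then obtain L where L: "\<And>j. j \<in> J \<Longrightarrow> (\<lambda>n. X n j) \<longlonglongrightarrow> L j"
    unfolding convergent_def by metis
  have lim: "(\<lambda>n. coord_norm J (\<lambda>j. X n j - L j)) \<longlonglongrightarrow> 0"
  proof -
    have "(\<lambda>n. sqrt (\<Sum>j\<in>J. (cmod (X n j - L j))\<^sup>2)) \<longlonglongrightarrow> sqrt (\<Sum>j\<in>J. (cmod (L j - L j))\<^sup>2)"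
      by (intro tendsto_intros L)
    thus ?thesis by (simp add: coord_norm_def L2_set_def)
  qed
  have sym: "coord_norm J (\<lambda>j. x j - y j) = coord_norm J (\<lambda>j. y j - x j)" for x y
    by (simp add: coord_norm_def norm_minus_commute)
  have "coord_norm J (\<lambda>j. T L j - L j)
      \<le> r * coord_norm J (\<lambda>j. X n j - L j) + coord_norm J (\<lambda>j. X (Suc n) j - L j)" for n
    using coord_norm_triangle[of J "T L" L "X (Suc n)"] contr[of L "X n"]
    by (simp add: X_Suc sym[of L "X n"])
  moreover have "(\<lambda>n. r * coord_norm J (\<lambda>j. X n j - L j) + coord_norm J (\<lambda>j. X (Suc n) j - L j))
      \<longlonglongrightarrow> r * 0 + 0"
    by (intro tendsto_intros lim filterlim_compose[OF lim filterlim_Suc])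
  ultimately have "coord_norm J (\<lambda>j. T L j - L j) \<le> 0"
    by (intro LIMSEQ_le_const[where a = "coord_norm J (\<lambda>j. T L j - L j)"]) auto
  hence "coord_norm J (\<lambda>j. T L j - L j) = 0"
    using coord_norm_nonneg by (rule order_antisym)
  thus ?thesis using coord_norm_eq_0_iff[OF J] by auto
qed

text \<open>
  Moving the negative terms to the other side, the decomposition on \<open>F\<close> says that the vectors
  \<open>(1, \<phi>_l(z) u_l(z))_l\<close> and \<open>(g(z), u_l(z))_l\<close> have the same Gram matrix. The lurking
  isometry gives \<open>V (1, \<phi>_l(z) u_l(z)) = (g(z), u_l(z))\<close> on \<open>F\<close>. At any other point
  \<open>z\<close> this becomes an equation for unknown \<open>f(z)\<close> and \<open>h_l(z)\<close>, which is solvable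
  because \<open>h \<mapsto> (\<phi>_l(z) h_l)\<close> is a strict contraction. Reading the equality of the Gram
  matrices backwards gives the decomposition of \<open>f\<close>. This is the transfer function realization
  without its formula.
\<close>

lemma agler_decomposition_extends:
  fixes \<phi> :: "'i \<Rightarrow> 'a \<Rightarrow> complex"
  assumes S: "finite S" and F: "finite F"
    and bound: "\<And>l z. l \<in> S \<Longrightarrow> z \<in> \<Omega> \<Longrightarrow> cmod (\<phi> l z) < 1"
    and dec: "\<And>z w. z \<in> F \<Longrightarrow> w \<in> F \<Longrightarrow>
      1 - g z * cnj (g w) = (\<Sum>l\<in>S. (1 - \<phi> l z * cnj (\<phi> l w)) * (u l z * cnj (u l w)))"
  shows "\<exists>f h. (\<forall>z\<in>F. f z = g z) \<and> (\<forall>z\<in>\<Omega>. \<forall>w\<in>\<Omega>.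
      1 - f z * cnj (f w) = (\<Sum>l\<in>S. (1 - \<phi> l z * cnj (\<phi> l w)) * (h l z * cnj (h l w))))"
proof -
  define J where "J = insert None (Some ` S)"
  have J: "finite J" using S by (simp add: J_def)
  have sum_J: "(\<Sum>j\<in>J. t j) = t None + (\<Sum>l\<in>S. t (Some l))" for t :: "'i option \<Rightarrow> complex"
    using S by (simp add: J_def sum.reindex)
  (* Coordinate None is the scalar one and carries the values of f; Some l carries the l-th summand. *)
  define inp where "inp = (\<lambda>z y. case_option (1 :: complex) (\<lambda>l. \<phi> l z * y (Some l)))"
  define out where "out = (\<lambda>z. case_option (g z) (\<lambda>l. u l z))"
  have gram: "coord_inner J (inp z (out z)) (inp w (out w)) = coord_inner J (out z) (out w)"
    if "z \<in> F" "w \<in> F" for z w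
    using dec[OF that]
    by (simp add: coord_inner_def sum_J inp_def out_def algebra_simps sum_subtractf)
  obtain V where V: "coord_linear V" "coord_isometry J V"
    and V_F: "\<And>z j. z \<in> F \<Longrightarrow> j \<in> J \<Longrightarrow> V (inp z (out z)) j = out z j"
    using lurking_isometry[OF J F, of "\<lambda>z. inp z (out z)" out] gram by metis
  have V_norm: "coord_norm J (V x) = coord_norm J x" for x
  proof -
    have "complex_of_real ((coord_norm J (V x))\<^sup>2) = of_real ((coord_norm J x)\<^sup>2)"
      using V(2) by (simp only: coord_isometry_def flip: coord_inner_self)
    thus ?thesis using coord_norm_nonneg power2_eq_iff_nonneg of_real_eq_iff by metis
  qed
  (* In inp z y the coordinate None is constant and the others are damped by \<phi>, so it contracts in y. *)
  have loop: "\<exists>y. \<forall>j\<in>J. V (inp z y) j = y j" if z: "z \<in> \<Omega>" for z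
  proof -
    define r where "r = Max (insert 0 ((\<lambda>l. cmod (\<phi> l z)) ` S))"
    have r: "0 \<le> r" "r < 1" and le: "\<And>l. l \<in> S \<Longrightarrow> cmod (\<phi> l z) \<le> r"
      using S bound z by (auto simp: r_def)
    show ?thesis
    proof (rule coord_contraction_fixed_point[OF J r])
      fix x y :: "'i option \<Rightarrow> complex"
      have "coord_norm J (\<lambda>j. V (inp z x) j - V (inp z y) j) = coord_norm J (\<lambda>j. inp z x j - inp z y j)"
        using V_norm by (simp flip: coord_linear_diff[OF V(1)])
      also have "\<dots> \<le> L2_set (\<lambda>j. r * cmod (x j - y j)) J"
        unfolding coord_norm_def
        by (rule L2_set_mono)
          (use r le in \<open>auto simp: J_def inp_def norm_mult mult_right_mono simp flip: right_diff_distrib\<close>)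
      also have "\<dots> = r * coord_norm J (\<lambda>j. x j - y j)"
        using r by (simp add: coord_norm_def L2_set_right_distrib)
      finally show "coord_norm J (\<lambda>j. V (inp z x) j - V (inp z y) j) \<le> r * coord_norm J (\<lambda>j. x j - y j)" .
    qed
  qed
  (* On F the given values already solve the equation; choosing them there makes f extend g. *)
  have "\<exists>y. (z \<in> F \<longrightarrow> y = out z) \<and> (z \<in> \<Omega> \<longrightarrow> (\<forall>j\<in>J. V (inp z y) j = y j))" for z
    using loop V_F by (cases "z \<in> F") auto
  then obtain Y where Y_F: "\<And>z. z \<in> F \<Longrightarrow> Y z = out z"
    and Y: "\<And>z j. z \<in> \<Omega> \<Longrightarrow> j \<in> J \<Longrightarrow> V (inp z (Y z)) j = Y z j"
    by metis
  have "1 - Y z None * cnj (Y w None)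
      = (\<Sum>l\<in>S. (1 - \<phi> l z * cnj (\<phi> l w)) * (Y z (Some l) * cnj (Y w (Some l))))"
    if z: "z \<in> \<Omega>" "w \<in> \<Omega>" for z w
  proof -
    have "coord_inner J (Y z) (Y w) = coord_inner J (V (inp z (Y z))) (V (inp w (Y w)))"
      using Y z by (intro coord_inner_cong) auto
    also have "\<dots> = coord_inner J (inp z (Y z)) (inp w (Y w))"
      using V(2) by (simp add: coord_isometry_def)
    finally show ?thesis
      by (simp add: coord_inner_def sum_J inp_def algebra_simps sum_subtractf)
  qed
  moreover have "\<forall>z\<in>F. Y z None = g z" using Y_F by (simp add: out_def)
  ultimately show ?thesis
    by (intro exI[of _ "\<lambda>z. Y z None"] exI[of _ "\<lambda>l z. Y z (Some l)"]) auto
qed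

section \<open>Two-point duality\<close>

text \<open>
  The dual of the cone of decomposable matrices consists of the admissible kernels on the two points:
  pairing a Hermitian matrix with \<open>(1 - \<psi>(z) cnj (\<psi>(w))) v(z) cnj (v(w))\<close> is the quadratic
  form of \<open>(1 - \<psi>(z) cnj (\<psi>(w))) k(z, w)\<close> at \<open>cnj v\<close>, for the kernel \<open>k\<close> given by
  that matrix. The hypothesis \<open>strict\<close> says that \<open>1 - g(z) cnj (g(w))\<close> pairs strictly positively
  with every such kernel whose diagonal does not vanish.
\<close>

lemma two_point_agler_decomposition:
  fixes \<Psi> :: "('a \<Rightarrow> complex) set"
  assumes z: "z1 \<in> \<Omega>" "z2 \<in> \<Omega>" "z1 \<noteq> z2" and t: "t\<^sup>2 < 1"
    and strict: "\<And>k. k \<in> admissible_kernels \<Omega> \<Psi> \<Longrightarrow> k z1 z1 \<noteq> 0 \<Longrightarrow> k z2 z2 \<noteq> 0 \<Longrightarrow>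
      (cmod (k z1 z2))\<^sup>2 < (1 - t\<^sup>2) * (Re (k z1 z1) * Re (k z2 z2))"
    and g: "g = (\<lambda>z. if z = z1 then 0 else of_real t)"
  shows "\<exists>(S :: (real \<times> complex \<times> real) set) \<phi> u. finite S \<and>
    (\<forall>l\<in>S. \<phi> l \<in> insert (\<lambda>_. 0) \<Psi>) \<and>
    (\<forall>z\<in>{z1, z2}. \<forall>w\<in>{z1, z2}.
      1 - g z * cnj (g w) = (\<Sum>l\<in>S. (1 - \<phi> l z * cnj (\<phi> l w)) * (u l z * cnj (u l w))))"
proof -
  define defect where "defect = (\<lambda>(\<psi> :: 'a \<Rightarrow> complex) v z w. (1 - \<psi> z * cnj (\<psi> w)) * (v z * cnj (v w)) :: complex)"
  (* Hermitian 2 x 2 matrices as a real Euclidean space: diagonal and upper right entry. *)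
  define coords where "coords = (\<lambda>G :: 'a \<Rightarrow> 'a \<Rightarrow> complex. (Re (G z1 z1), G z1 z2, Re (G z2 z2)))"
  define gens where "gens = {coords (defect \<psi> v) | \<psi> v. \<psi> \<in> insert (\<lambda>_. 0) \<Psi>}"
  define M where "M = (1 :: real, 1 :: complex, 1 - t\<^sup>2)"
  have defect_scale: "coords (defect \<psi> (\<lambda>z. of_real c * v z)) = c\<^sup>2 *\<^sub>R coords (defect \<psi> v)" for \<psi> v c
    by (simp add: coords_def defect_def scaleR_conv_of_real power2_eq_square algebra_simps)
  (* The set gens is closed under nonnegative scaling, so its convex hull is the cone it generates. *)
  have "M \<in> convex hull gens"
  proof (rule ccontr)
    assume "M \<notin> convex hull gens"
    have "0 \<in> gens"
      unfolding gens_def by (auto intro!: exI[of _ "\<lambda>_. 0"] simp: coords_def defect_def zero_prod_def)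
    have "\<exists>a b. a \<noteq> 0 \<and> (\<forall>x\<in>{M}. inner a x \<le> b) \<and> (\<forall>x\<in>convex hull gens. b \<le> inner a x)"
      by (rule separating_hyperplane_sets)
        (use \<open>M \<notin> convex hull gens\<close> \<open>0 \<in> gens\<close> in \<open>auto simp: convex_convex_hull\<close>)
    then obtain a b where a: "a \<noteq> 0" and aM: "inner a M \<le> b"
      and ab: "\<And>x. x \<in> convex hull gens \<Longrightarrow> b \<le> inner a x"
      by blast
    have b: "b \<le> 0" using ab[OF hull_inc[OF \<open>0 \<in> gens\<close>]] by simp
    have pos: "0 \<le> inner a (coords (defect \<psi> v))" if \<psi>: "\<psi> \<in> insert (\<lambda>_. 0) \<Psi>" for \<psi> v
    proof (rule ccontr)
      define s where "s = inner a (coords (defect \<psi> v))"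
      assume "\<not> 0 \<le> inner a (coords (defect \<psi> v))"
      hence s: "s < 0" by (simp add: s_def)
      (* This scaling would bring the generator to height b - 1, below the hyperplane. *)
      define c where "c = sqrt ((b - 1) / s)"
      have "c\<^sup>2 = (b - 1) / s" using b s by (simp add: c_def divide_nonpos_neg)
      hence "c\<^sup>2 * s = b - 1" using s by simp
      moreover have "c\<^sup>2 *\<^sub>R coords (defect \<psi> v) \<in> gens"
        unfolding gens_def using \<psi> defect_scale by (metis (mono_tags, lifting) mem_Collect_eq)
      from ab[OF hull_inc[OF this]] have "b \<le> c\<^sup>2 * s" by (simp add: s_def)
      ultimately show False by simp
    qed
    obtain p q r where apqr: "a = (p, q, r)" by (cases a)
    (* The factor 1/2: in the quadratic form the off-diagonal entry is counted together with its
       conjugate, in the inner product of coordinates once. *)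
    define k where "k = (\<lambda>z w.
       if z = z1 \<and> w = z1 then of_real p else if z = z1 \<and> w = z2 then cnj q / 2
       else if z = z2 \<and> w = z1 then q / 2 else if z = z2 \<and> w = z2 then of_real r else 0)"
    have k_simps: "k z1 z1 = of_real p" "k z1 z2 = cnj q / 2" "k z2 z1 = q / 2" "k z2 z2 = of_real r"
      using z by (auto simp: k_def)
    have k_outside: "k v w = 0" if "v \<notin> {z1, z2} \<or> w \<notin> {z1, z2}" for v w
      using that unfolding k_def insert_iff empty_iff by argo
    have adm: "k \<in> admissible_kernels \<Omega> \<Psi>"
    proof (rule admissible_kernelsI, rule psd_onI_finite_support[of "{z1, z2}"])
      fix \<psi> and c :: "'a \<Rightarrow> complex"
      assume \<psi>: "\<psi> \<in> insert (\<lambda>_. 0) \<Psi>"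
      define y where "y = defect \<psi> (\<lambda>z. cnj (c z)) z1 z2"
      have "(\<Sum>v\<in>{z1, z2}. \<Sum>w\<in>{z1, z2}. cnj (c v) * ((1 - \<psi> v * cnj (\<psi> w)) * k v w) * c w)
        = of_real p * defect \<psi> (\<lambda>z. cnj (c z)) z1 z1 + (cnj q * y + cnj (cnj q * y)) / 2
          + of_real r * defect \<psi> (\<lambda>z. cnj (c z)) z2 z2"
        using z(3) by (simp add: k_simps y_def defect_def algebra_simps add_divide_distrib diff_divide_distrib)
      also have "\<dots> = of_real (inner a (coords (defect \<psi> (\<lambda>z. cnj (c z)))))"
      proof -
        have real: "defect \<psi> v w w = of_real (Re (defect \<psi> v w w))" for v w
          by (simp add: defect_def complex_eq_iff)
        show ?thesis unfolding complex_add_cnj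
          by (subst real[of _ z1], subst real[of _ z2])
            (simp add: apqr coords_def y_def[symmetric] inner_complex_def)
      qed
      finally show "(\<Sum>v\<in>{z1, z2}. \<Sum>w\<in>{z1, z2}. cnj (c v) * ((1 - \<psi> v * cnj (\<psi> w)) * k v w) * c w) \<in> \<real>\<^sub>\<ge>\<^sub>0"
        using pos[OF \<psi>] by simp
    qed (simp_all add: k_outside)
    hence psd: "psd_on \<Omega> k" by (simp add: admissible_kernels_def)
    have p: "0 \<le> p" and r: "0 \<le> r"
      using psd_on_diagonal[OF psd z(1)] psd_on_diagonal[OF psd z(2)] by (simp_all add: k_simps)
    have q: "(cmod q)\<^sup>2 \<le> 4 * (p * r)"
      using psd_on_cauchy_schwarz[OF psd z(1,2)] by (simp add: k_simps norm_divide power_divide)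
    have "inner a M = p + Re q + (1 - t\<^sup>2) * r"
      by (simp add: apqr M_def inner_complex_def)
    with aM b have neg: "p + Re q + (1 - t\<^sup>2) * r \<le> 0" by simp
    show False
    (* If a diagonal entry vanishes, then so does q, and t^2 < 1 forces the functional a to be 0. *)
    proof (cases "p = 0 \<or> r = 0")
      case True
      hence q0: "q = 0" using q by auto
      have "0 \<le> (1 - t\<^sup>2) * r" using t r by simp
      moreover have "Re q = 0" using q0 by simp
      ultimately have "p = 0" "(1 - t\<^sup>2) * r = 0" using neg p by linarith+
      with t have "r = 0" by auto
      with \<open>p = 0\<close> q0 a apqr show False by (simp add: zero_prod_def)
    next
      case False
      (* |q| is less than twice the geometric mean of p and (1 - t^2) r, so at most their sum. *)
      have "(cmod q)\<^sup>2 < 4 * (p * ((1 - t\<^sup>2) * r))"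
        using strict[OF adm] False by (simp add: k_simps norm_divide power_divide algebra_simps)
      also have "\<dots> \<le> (p + (1 - t\<^sup>2) * r)\<^sup>2"
        using sum_squares_bound[of p "(1 - t\<^sup>2) * r"] unfolding power2_sum mult.assoc by linarith
      finally have "cmod q < p + (1 - t\<^sup>2) * r"
        by (rule power2_less_imp_less) (use p r t in simp)
      moreover have "- Re q \<le> cmod q" using abs_Re_le_cmod[of q] by simp
      ultimately show False using neg by simp
    qed
  qed
  then obtain S c where S: "finite S" "S \<subseteq> gens" and c: "\<And>x. x \<in> S \<Longrightarrow> 0 \<le> c x"
    and sum: "(\<Sum>x\<in>S. c x *\<^sub>R x) = M"
    unfolding convex_hull_explicit by auto
  have "\<forall>x\<in>S. \<exists>\<psi> v. \<psi> \<in> insert (\<lambda>_. 0) \<Psi> \<and> x = coords (defect \<psi> v)"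
    using S(2) unfolding gens_def by blast
  then obtain \<phi> v where \<phi>: "\<And>x. x \<in> S \<Longrightarrow> \<phi> x \<in> insert (\<lambda>_. 0) \<Psi>"
    and v: "\<And>x. x \<in> S \<Longrightarrow> x = coords (defect (\<phi> x) (v x))"
    by metis
  (* The convex coefficients are absorbed into the rank-one factors. *)
  define u where "u = (\<lambda>x z. of_real (sqrt (c x)) * v x z)"
  have "coords (defect (\<phi> x) (u x)) = c x *\<^sub>R x" if "x \<in> S" for x
    using c[OF that] by (simp add: u_def defect_scale flip: v[OF that])
  hence M: "(\<Sum>x\<in>S. coords (defect (\<phi> x) (u x))) = M" using sum by simp
  define D where "D = (\<lambda>z w. \<Sum>x\<in>S. defect (\<phi> x) (u x) z w)"
  have herm: "cnj (D z w) = D w z" for z w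
    by (simp add: D_def defect_def mult_ac)
  have "coords D = (\<Sum>x\<in>S. coords (defect (\<phi> x) (u x)))"
    by (simp add: coords_def D_def prod_eq_iff fst_sum snd_sum)
  hence D: "Re (D z1 z1) = 1" "D z1 z2 = 1" "Re (D z2 z2) = 1 - t\<^sup>2"
    unfolding M by (simp_all add: coords_def M_def)
  have "Im (D z z) = 0" for z using herm[of z z] by (simp add: complex_eq_iff)
  with D have "D z1 z1 = 1" "D z2 z2 = of_real (1 - t\<^sup>2)" by (simp_all add: complex_eq_iff)
  moreover have "D z2 z1 = 1" using herm[of z1 z2] D(2) by simp
  ultimately have "\<forall>z\<in>{z1, z2}. \<forall>w\<in>{z1, z2}. 1 - g z * cnj (g w) = D z w"
    using D(2) z(3) by (auto simp: g power2_eq_square)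
  thus ?thesis
    using S(1) \<phi> unfolding D_def defect_def
    by (intro exI[of _ S] exI[of _ \<phi>] exI[of _ u] conjI ballI) blast+
qed

text \<open>
  The Cauchy-Schwarz inequality for \<open>(1 - f(z) cnj (f(w))) k(z, w)\<close> at the two points, divided by
  \<open>|1 - a cnj b|\<^sup>2\<close> for \<open>a = f(z_1)\<close> and \<open>b = f(z_2)\<close>.
\<close>

lemma moebius_dist_kernel_bound:
  assumes f: "f \<in> schur_agler_class \<Omega> \<Psi>" "f ` \<Omega> \<subseteq> ball 0 1"
    and k: "k \<in> admissible_kernels \<Omega> \<Psi>" "k z1 z1 \<noteq> 0" "k z2 z2 \<noteq> 0"
    and z: "z1 \<in> \<Omega>" "z2 \<in> \<Omega>"
  shows "moebius_dist (f z1) (f z2)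
    \<le> sqrt (1 - (cmod (k z1 z2))\<^sup>2 / (Re (k z1 z1) * Re (k z2 z2)))"
proof -
  define a b where "a = f z1" and "b = f z2"
  have ab: "cmod a < 1" "cmod b < 1" using f(2) z by (auto simp: a_def b_def)
  define K where "K = Re (k z1 z1) * Re (k z2 z2)"
  define \<delta> where "\<delta> = (cmod (1 - a * cnj b))\<^sup>2"
  have psd: "psd_on \<Omega> k" using k(1) by (simp add: admissible_kernels_def)
  have K: "0 < K"
    using psd_on_diagonal[OF psd z(1)] psd_on_diagonal[OF psd z(2)] k(2,3)
    by (auto simp: K_def complex_nonneg_Reals_iff complex_eq_iff)
  have "cmod (a * cnj b) < 1"
    using ab mult_strict_mono'[of "cmod a" 1 "cmod b" 1] by (simp add: norm_mult)
  hence "a * cnj b \<noteq> 1" by auto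
  hence \<delta>: "0 < \<delta>" by (simp add: \<delta>_def)
  have id: "\<delta> - (cmod (a - b))\<^sup>2 = (1 - (cmod a)\<^sup>2) * (1 - (cmod b)\<^sup>2)"
    unfolding \<delta>_def cmod_power2 by (simp add: algebra_simps power2_eq_square)
  have "psd_on \<Omega> (\<lambda>z w. (1 - f z * cnj (f w)) * k z w)"
    using f(1) k(1) by (auto simp: schur_agler_class_def)
  note psd_on_cauchy_schwarz[OF this z]
  moreover have "Im (k z1 z1) = 0" "Im (k z2 z2) = 0"
    using psd_on_diagonal[OF psd z(1)] psd_on_diagonal[OF psd z(2)]
    by (auto simp: complex_nonneg_Reals_iff)
  moreover have "Re ((1 - c * cnj c) * y) = (1 - (cmod c)\<^sup>2) * Re y" if "Im y = 0" for c y
    using that by (simp add: cmod_power2, simp add: power2_eq_square)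
  ultimately have "\<delta> * (cmod (k z1 z2))\<^sup>2 \<le> (1 - (cmod a)\<^sup>2) * (1 - (cmod b)\<^sup>2) * K"
    unfolding a_def[symmetric] b_def[symmetric] \<delta>_def K_def norm_mult power_mult_distrib
    by (simp only: mult_ac)
  hence "\<delta> * (cmod (k z1 z2))\<^sup>2 / K \<le> \<delta> - (cmod (a - b))\<^sup>2"
    using K by (simp add: id pos_divide_le_eq)
  hence "(cmod (a - b))\<^sup>2 / \<delta> \<le> 1 - (cmod (k z1 z2))\<^sup>2 / K"
    unfolding pos_divide_le_eq[OF \<delta>] by (simp add: algebra_simps)
  hence "(moebius_dist a b)\<^sup>2 \<le> 1 - (cmod (k z1 z2))\<^sup>2 / K"
    by (simp add: moebius_dist_def norm_divide power_divide \<delta>_def)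
  thus ?thesis by (simp add: real_le_rsqrt K_def a_def b_def)
qed

text \<open>
  Agler's interpolation theorem for two points, one of them sent to 0, with the positivity condition
  on the kernels in its strict form.
\<close>

lemma schur_agler_two_point_interpolation:
  fixes \<Psi> :: "('a \<Rightarrow> complex) set"
  assumes bound: "\<And>\<psi> z. \<psi> \<in> \<Psi> \<Longrightarrow> z \<in> \<Omega> \<Longrightarrow> cmod (\<psi> z) < 1"
    and z: "z1 \<in> \<Omega>" "z2 \<in> \<Omega>" "z1 \<noteq> z2" and t: "t\<^sup>2 < 1"
    and strict: "\<And>k. k \<in> admissible_kernels \<Omega> \<Psi> \<Longrightarrow> k z1 z1 \<noteq> 0 \<Longrightarrow> k z2 z2 \<noteq> 0 \<Longrightarrow>
      (cmod (k z1 z2))\<^sup>2 < (1 - t\<^sup>2) * (Re (k z1 z1) * Re (k z2 z2))"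
  shows "\<exists>f \<in> schur_agler_class \<Omega> \<Psi>. f z1 = 0 \<and> f z2 = of_real t"
proof -
  define g where "g = (\<lambda>z. if z = z1 then 0 else complex_of_real t)"
  obtain S :: "(real \<times> complex \<times> real) set" and \<phi> u where S: "finite S"
    and \<phi>_all: "\<forall>l\<in>S. \<phi> l \<in> insert (\<lambda>_. 0) \<Psi>"
    and dec_all: "\<forall>z\<in>{z1, z2}. \<forall>w\<in>{z1, z2}.
      1 - g z * cnj (g w) = (\<Sum>l\<in>S. (1 - \<phi> l z * cnj (\<phi> l w)) * (u l z * cnj (u l w)))"
  proof -
    have "\<exists>(S :: (real \<times> complex \<times> real) set) \<phi> u. finite S \<and>
      (\<forall>l\<in>S. \<phi> l \<in> insert (\<lambda>_. 0) \<Psi>) \<and>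
      (\<forall>z\<in>{z1, z2}. \<forall>w\<in>{z1, z2}.
        1 - g z * cnj (g w) = (\<Sum>l\<in>S. (1 - \<phi> l z * cnj (\<phi> l w)) * (u l z * cnj (u l w))))"
      by (rule two_point_agler_decomposition[OF z t _ g_def]) (erule (2) strict)
    with that show thesis by (elim exE conjE)
  qed
  note \<phi> = bspec[OF \<phi>_all] and dec = bspec[OF bspec[OF dec_all]]
  have bound\<phi>: "cmod (\<phi> l z) < 1" if "l \<in> S" "z \<in> \<Omega>" for l z
    using \<phi>[OF that(1)] bound that(2) by auto
  have "\<exists>f h. (\<forall>z\<in>{z1, z2}. f z = g z) \<and> (\<forall>z\<in>\<Omega>. \<forall>w\<in>\<Omega>.
      1 - f z * cnj (f w) = (\<Sum>l\<in>S. (1 - \<phi> l z * cnj (\<phi> l w)) * (h l z * cnj (h l w))))"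
    by (rule agler_decomposition_extends[where u = u, OF S])
      (simp, erule (1) bound\<phi>, erule (1) dec)
  then obtain f h where f: "\<forall>z\<in>{z1, z2}. f z = g z"
    and ext: "\<forall>z\<in>\<Omega>. \<forall>w\<in>\<Omega>.
      1 - f z * cnj (f w) = (\<Sum>l\<in>S. (1 - \<phi> l z * cnj (\<phi> l w)) * (h l z * cnj (h l w)))"
    by (elim exE conjE)
  have "f \<in> schur_agler_class \<Omega> \<Psi>"
    using \<phi>_all ext by (intro schur_agler_class_decomposition[where S = S and \<phi> = \<phi> and h = h]) auto
  moreover have "f z1 = 0" "f z2 = of_real t" using f z(3) by (auto simp: g_def)
  ultimately show ?thesis by blast
qed

text \<open>
  If the supremum were below the infimum, there would be room for \<open>s < t\<close> between them. The
  interpolating function for \<open>t\<close> need only be bounded by 1; the multiple \<open>(s / t) f\<close> has values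
  in the open disc and still attains the distance \<open>s\<close>, which exceeds the supremum.
\<close>

lemma d_Psi_eq_Inf_kernels:
  fixes \<Psi> :: "('a \<Rightarrow> complex) set"
  assumes bound: "\<And>\<psi> z. \<psi> \<in> \<Psi> \<Longrightarrow> z \<in> \<Omega> \<Longrightarrow> cmod (\<psi> z) < 1"
    and z: "z1 \<in> \<Omega>" "z2 \<in> \<Omega>"
  shows "d_Psi \<Omega> \<Psi> z1 z2 =
    Inf {sqrt (1 - (cmod (k z1 z2))\<^sup>2 / (Re (k z1 z1) * Re (k z2 z2))) | k.
      k \<in> admissible_kernels \<Omega> \<Psi> \<and> k z1 z1 \<noteq> 0 \<and> k z2 z2 \<noteq> 0}" (is "_ = Inf ?K")
proof -
  define D where "D = {moebius_dist (f z1) (f z2) | f. f \<in> schur_agler_class \<Omega> \<Psi> \<and> f ` \<Omega> \<subseteq> ball 0 1}"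
  define \<delta> :: "'a \<Rightarrow> 'a \<Rightarrow> complex" where "\<delta> = (\<lambda>z w. of_bool (z = w \<and> z \<in> {z1, z2}))"
  have \<delta>: "\<delta> \<in> admissible_kernels \<Omega> \<Psi>"
    unfolding \<delta>_def using z by (intro diagonal_kernel_admissible bound) auto
  have \<delta>K: "sqrt (1 - (cmod (\<delta> z1 z2))\<^sup>2 / (Re (\<delta> z1 z1) * Re (\<delta> z2 z2))) \<in> ?K"
    using \<delta> by (auto intro!: exI[of _ \<delta>] simp: \<delta>_def)
  hence K_ne: "?K \<noteq> {}" by blast
  have D_le_K: "d \<le> x" if "d \<in> D" "x \<in> ?K" for d x
    using that z by (auto simp: D_def intro!: moebius_dist_kernel_bound)
  have zero: "(\<lambda>_. 0) \<in> schur_agler_class \<Omega> \<Psi>"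
    by (simp add: schur_agler_class_def admissible_kernels_def)
  have D0: "0 \<in> D"
    unfolding D_def using zero by (auto intro!: exI[of _ "\<lambda>_. 0"] simp: moebius_dist_def)
  have bddK: "bdd_below ?K" using D_le_K[OF D0] by (rule bdd_belowI)
  have bddD: "bdd_above D" using D_le_K \<delta>K by (meson bdd_aboveI)
  have "Inf ?K \<le> Sup D"
  proof (rule ccontr)
    assume "\<not> Inf ?K \<le> Sup D"
    then obtain s t where st: "Sup D < s" "s < t" "t < Inf ?K" by (meson dense not_le)
    have pos: "0 < s" "0 < t" using st cSup_upper[OF D0 bddD] by auto
    have t_less: "t < sqrt (1 - (cmod (k z1 z2))\<^sup>2 / (Re (k z1 z1) * Re (k z2 z2)))"
      if "k \<in> admissible_kernels \<Omega> \<Psi>" "k z1 z1 \<noteq> 0" "k z2 z2 \<noteq> 0" for k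
      by (rule less_le_trans[OF st(3) cInf_lower[OF _ bddK]]) (use that in blast)
    (* For z1 = z2 the kernel \<delta> shows that the infimum is 0. *)
    have ne: "z1 \<noteq> z2"
      using t_less[OF \<delta>] pos by (auto simp: \<delta>_def)
    have "t < 1" using t_less[OF \<delta>] ne by (simp add: \<delta>_def)
    hence t1: "t\<^sup>2 < 1" using pos by (simp add: power_less_one_iff)
    have strict: "(cmod (k z1 z2))\<^sup>2 < (1 - t\<^sup>2) * (Re (k z1 z1) * Re (k z2 z2))"
      if k: "k \<in> admissible_kernels \<Omega> \<Psi>" "k z1 z1 \<noteq> 0" "k z2 z2 \<noteq> 0" for k
    proof -
      have psd: "psd_on \<Omega> k" using k(1) by (simp add: admissible_kernels_def)
      have "0 < Re (k z1 z1) * Re (k z2 z2)"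
        using psd_on_diagonal[OF psd z(1)] psd_on_diagonal[OF psd z(2)] k(2,3)
        by (auto simp: complex_nonneg_Reals_iff complex_eq_iff)
      moreover have "t\<^sup>2 < 1 - (cmod (k z1 z2))\<^sup>2 / (Re (k z1 z1) * Re (k z2 z2))"
        using t_less[OF k] pos by (metis less_imp_le real_less_rsqrt real_sqrt_less_iff real_sqrt_abs abs_of_nonneg)
      ultimately show ?thesis
        by (simp add: pos_divide_less_eq[symmetric])
    qed
    have "\<exists>f\<in>schur_agler_class \<Omega> \<Psi>. f z1 = 0 \<and> f z2 = of_real t"
      by (rule schur_agler_two_point_interpolation[OF _ z ne t1]) (erule (1) bound, erule (2) strict)
    then obtain f where f: "f \<in> schur_agler_class \<Omega> \<Psi>" "f z1 = 0" "f z2 = of_real t"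
      by blast
    define r where "r = s / t"
    have r: "0 \<le> r" "r < 1" using st pos by (simp_all add: r_def)
    have "cmod (of_real r * f w) < 1" if "w \<in> \<Omega>" for w
    proof -
      have "cmod (f w) \<le> 1"
        by (rule schur_agler_class_norm_le_one[OF f(1) that]) (erule (1) bound)
      hence "cmod (of_real r * f w) \<le> r"
        using r
        by (simp add: norm_mult mult_left_le)
      thus ?thesis using r by simp
    qed
    moreover have "(\<lambda>w. of_real r * f w) \<in> schur_agler_class \<Omega> \<Psi>"
      using schur_agler_class_scale[OF f(1)] r by simp
    moreover have "moebius_dist (of_real r * f z1) (of_real r * f z2) = s"
      using f pos by (simp add: moebius_dist_def r_def norm_divide)
    ultimately have "s \<in> D"
      unfolding D_def by (auto intro!: exI[of _ "\<lambda>w. of_real r * f w"])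
    thus False using cSup_upper[OF _ bddD] st(1) by fastforce
  qed
  moreover have "Sup D \<le> Inf ?K"
    using D0 K_ne D_le_K by (intro cSup_least cInf_greatest) auto
  ultimately show ?thesis by (simp add: d_Psi_def D_def)
qed

theorem theorem2p1:
  fixes \<Omega> :: "(complex ^ 'm) set"
    and \<Psi> :: "(complex ^ 'm \<Rightarrow> complex) set"
    and z1 z2 :: "complex ^ 'm"
  assumes "complex_domain \<Omega>"
    and "caratheodory_hyperbolic \<Omega>"
    and "\<Psi> \<subseteq> schur_class \<Omega>"
    and "test_functions \<Omega> \<Psi>"
    and "\<exists>w0\<in>\<Omega>. \<forall>\<psi>\<in>\<Psi>. \<psi> w0 = 0"
    and "z1 \<in> \<Omega>" and "z2 \<in> \<Omega>"
  shows "d_Psi \<Omega> \<Psi> z1 z2 =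
    Inf {sqrt (1 - (cmod (k z1 z2))\<^sup>2 / (Re (k z1 z1) * Re (k z2 z2))) | k.
      k \<in> admissible_kernels \<Omega> \<Psi> \<and> k z1 z1 \<noteq> 0 \<and> k z2 z2 \<noteq> 0}"
proof (rule d_Psi_eq_Inf_kernels)
  fix \<psi> z assume \<psi>: "\<psi> \<in> \<Psi>" and z: "z \<in> \<Omega>"
  have "ennreal (cmod (\<psi> z)) \<le> (SUP \<psi>\<in>\<Psi>. ennreal (cmod (\<psi> z)))"
    using \<psi> by (intro SUP_upper) auto
  also have "\<dots> < 1" using assms(4) z by (simp add: test_functions_def)
  finally show "cmod (\<psi> z) < 1" by (simp add: ennreal_less_one_iff)
qed (use assms in auto)

end
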